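(* Let $K$ be a field of characteristic zero, let $n\ge 1$, and let $K_{\langle n\rangle}=K\langle X_1,\dots,X_n\rangle$. Then $$\operatorname{Ker}\delta=\sum_{1\le k\le n}[X_k,K_{\langle n\rangle}]+K1=K1+[K_{\langle n\rangle},K_{\langle n\rangle}]=\operatorname{Ker}C .$$
   Context: $K$ is a field of characteristic zero and $K_{\langle n\rangle}=K\langle X_1,\dots,X_n\rangle$ is the ring of polynomials in the noncommuting indeterminates $X_1,\dots,X_n$ with coefficients in $K$ (the free associative unital $K$-algebra). $K1$ is the subspace of constants. $[a,b]=ab-ba$; $[X_k,K_{\langle n\rangle}]=\{[X_k,P]:P\in K_{\langle n\rangle}\}$, and $[K_{\langle n\rangle},K_{\langle n\rangle}]$ is the $K$-linear span of all commutators $[P,Q]$ with $P,Q\in K_{\langle n\rangle}$. The partial generalized difference quotients $\partial_j:K_{\langle n\rangle}\to K_{\langle n\rangle}\otimes_K K_{\langle n\rangle}$ ($1\le j\le n$) are the ($K$-linear) derivations such that $\partial_jX_k=0$ if $k\ne j$ and $\partial_jX_j=1\otimes 1$, where $K_{\langle n\rangle}\otimes_K K_{\langle n\rangle}$ has the bimodule structure $a(b\otimes c)=ab\otimes c$, $(b\otimes c)d=b\otimes cd$. The partial cyclic derivatives are the linear maps $\delta_j=\tilde\mu\circ\partial_j:K_{\langle n\rangle}\to K_{\langle n\rangle}$, where $\tilde\mu(a\otimes b)=ba$. The cyclic gradient is the linear map $\delta:K_{\langle n\rangle}\to (K_{\langle n\rangle})^n$, $\delta P=(\delta_1P,\dots,\delta_nP)$.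 $C:K_{\langle n\rangle}\to K_{\langle n\rangle}$ is the linear map with $C1=0$ and, for $p\ge 1$, $CX_{i_1}\cdots X_{i_p}=\sum_{1\le j\le p}X_{i_{j+1}}\cdots X_{i_p}X_{i_1}\cdots X_{i_j}$. *)

theory Defs
  imports
    "HOL-Analysis.Finite_Cartesian_Product"
    "HOL-Library.Poly_Mapping"
    "HOL-Library.Set_Algebras"
begin

section \<open>Vector spaces of finitely supported functions\<close>

definition pm_scale :: "'k::field \<Rightarrow> ('a \<Rightarrow>\<^sub>0 'k) \<Rightarrow> ('a \<Rightarrow>\<^sub>0 'k)"
  where "pm_scale c = Poly_Mapping.map ((*) c)"

lemma lookup_pm_scale [simp]: "Poly_Mapping.lookup (pm_scale c p) x = c * Poly_Mapping.lookup p x"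
  unfolding pm_scale_def by transfer (simp add: when_def)

global_interpretation pm: vector_space "pm_scale :: 'k::field \<Rightarrow> ('a \<Rightarrow>\<^sub>0 'k) \<Rightarrow> ('a \<Rightarrow>\<^sub>0 'k)"
  by unfold_locales (auto intro!: poly_mapping_eqI simp: lookup_add algebra_simps)

text \<open>Linear extension of a function given on the standard basis, with values in a vector
  space whose scalar multiplication is \<open>s\<close>.\<close>

definition lin_ext :: "('k::field \<Rightarrow> 'v::ab_group_add \<Rightarrow> 'v) \<Rightarrow> ('a \<Rightarrow> 'v) \<Rightarrow> ('a \<Rightarrow>\<^sub>0 'k) \<Rightarrow> 'v"
  where "lin_ext s f p = (\<Sum>x\<in>Poly_Mapping.keys p. s (Poly_Mapping.lookup p x) (f x))"

lemma pm_expand: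
  fixes p :: "'a \<Rightarrow>\<^sub>0 'k::field"
  shows "p = (\<Sum>x\<in>Poly_Mapping.keys p. pm_scale (Poly_Mapping.lookup p x) (Poly_Mapping.single x 1))"
  by (rule poly_mapping_eqI)
     (auto simp: lookup_sum lookup_single when_def in_keys_iff if_distrib[of "(*) _"] cong: if_cong)

context vector_space
begin

lemma lin_ext_superset:
  assumes "finite A" "Poly_Mapping.keys p \<subseteq> A"
  shows "lin_ext scale f p = (\<Sum>x\<in>A. scale (Poly_Mapping.lookup p x) (f x))"
  unfolding lin_ext_def using assms
  by (intro sum.mono_neutral_left) (auto simp: in_keys_iff)

lemma linear_lin_ext: "Vector_Spaces.linear pm_scale scale (lin_ext scale f)"
proof (unfold_locales, goal_cases)
  case (1 p q)
  let ?A = "Poly_Mapping.keys p \<union> Poly_Mapping.keys q"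
  have "Poly_Mapping.keys (p + q) \<subseteq> ?A" by (rule keys_add)
  then show ?case
    by (simp add: lin_ext_superset[of ?A] lookup_add scale_left_distrib sum.distrib)
next
  case (2 c p)
  have "Poly_Mapping.keys (pm_scale c p) \<subseteq> Poly_Mapping.keys p" by (auto simp: in_keys_iff)
  then show ?case
    by (simp add: lin_ext_superset[of "Poly_Mapping.keys p"] scale_sum_right)
qed

lemma lin_ext_single [simp]: "lin_ext scale f (Poly_Mapping.single x 1) = f x"
  by (simp add: lin_ext_def)

end

lemma linear_pm_eqI:
  assumes "Vector_Spaces.linear pm_scale s f" "Vector_Spaces.linear pm_scale s g"
    and "\<And>x. f (Poly_Mapping.single x 1) = g (Poly_Mapping.single x 1)"
  shows "f = g"
proof
  fix p
  interpret f: Vector_Spaces.linear pm_scale s f by fact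
  interpret g: Vector_Spaces.linear pm_scale s g by fact
  show "f p = g p"
    by (subst (1 2) pm_expand) (simp add: f.sum g.sum f.scale g.scale assms(3))
qed

lemmas linear_lin_ext_pm = pm.linear_lin_ext
lemmas linear_pm_add = Vector_Spaces.linear.axioms(3)[THEN module_hom.add]
lemmas linear_pm_scale = Vector_Spaces.linear.axioms(3)[THEN module_hom.scale]

lemma linearI_pm:
  assumes "\<And>p q. f (p + q) = f p + f q" "\<And>c p. f (pm_scale c p) = pm_scale c (f p)"
  shows "Vector_Spaces.linear pm_scale pm_scale f"
  by unfold_locales (use assms in auto)

lemma linear_add_pm:
  assumes "Vector_Spaces.linear pm_scale pm_scale f" "Vector_Spaces.linear pm_scale pm_scale g"
  shows "Vector_Spaces.linear pm_scale pm_scale (\<lambda>x. f x + g x)"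
  by (rule linearI_pm)
     (simp_all add: assms[THEN linear_pm_add] assms[THEN linear_pm_scale] pm.scale_right_distrib)

section \<open>The free associative algebra\<close>

text \<open>The free monoid is written additively, because \<^const>\<open>times\<close> on finitely supported
  functions is convolution with respect to an additive monoid.\<close>

datatype 'n fword = FWord (letters: "'n list")

instantiation fword :: (type) monoid_add
begin
definition "0 = FWord []"
definition "v + w = FWord (letters v @ letters w)"
instance by standard (auto simp: zero_fword_def plus_fword_def)
end

text \<open>Polynomials in noncommuting indeterminates indexed by the finite type \<open>'n\<close>.\<close>

type_synonym ('n, 'k) ncpoly = "'n fword \<Rightarrow>\<^sub>0 'k"

definition mon :: "'n list \<Rightarrow> ('n, 'k::field) ncpoly"
  where "mon xs = Poly_Mapping.single (FWord xs) 1"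

definition X :: "'n \<Rightarrow> ('n, 'k::field) ncpoly"
  where "X k = mon [k]"

definition constants :: "('n, 'k::field) ncpoly set"
  where "constants = {pm_scale c 1 | c. True}"

definition commutator :: "'a::ring \<Rightarrow> 'a \<Rightarrow> 'a"
  where "commutator a b = a * b - b * a"

definition commutator_space :: "('n, 'k::field) ncpoly set"
  where "commutator_space = pm.span {commutator P Q | P Q. True}"

lemma mon_Nil: "mon [] = 1"
  by (simp add: mon_def zero_fword_def[symmetric])

lemma mon_append: "mon (xs @ ys) = mon xs * mon ys"
  by (simp add: mon_def mult_single plus_fword_def)

lemma mon_Cons: "mon (x # xs) = X x * mon xs"
  using mon_append[of "[x]" xs] by (simp add: X_def)

lemma pm_scale_mult:
  fixes P Q :: "('n, 'k::field) ncpoly"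
  shows "pm_scale c P * Q = pm_scale c (P * Q)" "P * pm_scale c Q = pm_scale c (P * Q)"
proof -
  have 1: "pm_scale d R = Poly_Mapping.single 0 d * R" for d and R :: "('n, 'k) ncpoly"
    by (simp add: pm_scale_def mult_map_scale_conv_mult)
  show "pm_scale c P * Q = pm_scale c (P * Q)" by (simp add: 1 mult.assoc)
  have 2: "R * Poly_Mapping.single 0 c = Poly_Mapping.single 0 c * R" for R :: "('n, 'k) ncpoly"
  proof -
    have "Vector_Spaces.linear pm_scale pm_scale (\<lambda>R::('n,'k) ncpoly. R * Poly_Mapping.single 0 c)"
      by (rule linearI_pm) (auto simp: distrib_right 1 mult.assoc)
    moreover have "Vector_Spaces.linear pm_scale pm_scale (\<lambda>R::('n,'k) ncpoly. Poly_Mapping.single 0 c * R)"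
      by (rule linearI_pm)
         (simp_all add: distrib_left 1 mult.assoc[symmetric] mult_single mult.commute)
    ultimately have "(\<lambda>R::('n,'k) ncpoly. R * Poly_Mapping.single 0 c) = (\<lambda>R. Poly_Mapping.single 0 c * R)"
      by (rule linear_pm_eqI) (simp add: mult_single)
    then show ?thesis by metis
  qed
  show "P * pm_scale c Q = pm_scale c (P * Q)"
    by (simp add: 1 mult.assoc[symmetric] 2)
qed

lemma linear_mult_left: "Vector_Spaces.linear pm_scale pm_scale (\<lambda>Q::('n,'k::field) ncpoly. P * Q)"
  by (rule linearI_pm) (simp_all add: distrib_left pm_scale_mult)

lemma linear_mult_right: "Vector_Spaces.linear pm_scale pm_scale (\<lambda>P::('n,'k::field) ncpoly. P * Q)"
  by (rule linearI_pm) (simp_all add: distrib_right pm_scale_mult)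

lemma linear_mon_eqI:
  fixes f g :: "('n, 'k::field) ncpoly \<Rightarrow> 'v::ab_group_add"
  assumes "Vector_Spaces.linear pm_scale s f" "Vector_Spaces.linear pm_scale s g" "\<And>xs. f (mon xs) = g (mon xs)"
  shows "f = g"
proof (rule linear_pm_eqI[OF assms(1,2)])
  show "f (Poly_Mapping.single x 1) = g (Poly_Mapping.single x 1)" for x
    using assms(3)[of "letters x"] by (simp add: mon_def)
qed

section \<open>The tensor square\<close>

text \<open>Pairs of words index the basis of the tensor square; that this is a tensor
  product is \<open>tensor_universal\<close>.\<close>

type_synonym ('n, 'k) nctensor = "('n fword \<times> 'n fword) \<Rightarrow>\<^sub>0 'k"

definition tensor :: "('n, 'k::field) ncpoly \<Rightarrow> ('n, 'k) ncpoly \<Rightarrow> ('n, 'k) nctensor"  (infixl \<open>\<otimes>\<^sub>t\<close> 72)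
  where "a \<otimes>\<^sub>t b =
    lin_ext pm_scale (\<lambda>u. lin_ext pm_scale (\<lambda>v. Poly_Mapping.single (u, v) 1) b) a"

lemma linear_tensor_right: "Vector_Spaces.linear pm_scale pm_scale (\<lambda>b. a \<otimes>\<^sub>t b)"
proof (rule linearI_pm)
  fix c :: 'a and p q :: "('b, 'a) ncpoly"
  note l = linear_lin_ext_pm[where f = "\<lambda>v. Poly_Mapping.single (u, v) 1" for u]
  show "a \<otimes>\<^sub>t (p + q) = a \<otimes>\<^sub>t p + a \<otimes>\<^sub>t q"
    unfolding tensor_def linear_pm_add[OF l]
    by (simp add: lin_ext_def[where p = a] pm.scale_right_distrib sum.distrib)
  show "a \<otimes>\<^sub>t pm_scale c p = pm_scale c (a \<otimes>\<^sub>t p)"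
    unfolding tensor_def linear_pm_scale[OF l]
    by (simp add: lin_ext_def[where p = a] pm.scale_sum_right mult.commute)
qed

lemma linear_tensor_left: "Vector_Spaces.linear pm_scale pm_scale (\<lambda>a. a \<otimes>\<^sub>t b)"
  unfolding tensor_def by (rule linear_lin_ext_pm)

lemma tensor_mon: "mon xs \<otimes>\<^sub>t mon ys = Poly_Mapping.single (FWord xs, FWord ys) 1"
  by (simp add: tensor_def mon_def)

lemma linear_tensor_eqI:
  fixes f g :: "('n, 'k::field) nctensor \<Rightarrow> 'v::ab_group_add"
  assumes "Vector_Spaces.linear pm_scale s f" "Vector_Spaces.linear pm_scale s g"
    and "\<And>xs ys. f (mon xs \<otimes>\<^sub>t mon ys) = g (mon xs \<otimes>\<^sub>t mon ys)"
  shows "f = g"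
proof (rule linear_pm_eqI[OF assms(1,2)])
  show "f (Poly_Mapping.single x 1) = g (Poly_Mapping.single x 1)" for x
    using assms(3)[of "letters (fst x)" "letters (snd x)"] by (simp add: tensor_mon)
qed

lemma linear_comp:
  "Vector_Spaces.linear s1 s2 f \<Longrightarrow> Vector_Spaces.linear s2 s3 g \<Longrightarrow> Vector_Spaces.linear s1 s3 (\<lambda>x. g (f x))"
  using Vector_Spaces.linear_compose[of s1 s2 f s3 g] by (simp add: o_def)

lemma bilinear_mon_eqI:
  fixes f g :: "('n, 'k::field) ncpoly \<Rightarrow> ('n, 'k) ncpoly \<Rightarrow> 'v::ab_group_add"
  assumes "\<And>a. Vector_Spaces.linear pm_scale s (f a)" "\<And>b. Vector_Spaces.linear pm_scale s (\<lambda>a. f a b)"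
    and "\<And>a. Vector_Spaces.linear pm_scale s (g a)" "\<And>b. Vector_Spaces.linear pm_scale s (\<lambda>a. g a b)"
    and "\<And>xs ys. f (mon xs) (mon ys) = g (mon xs) (mon ys)"
  shows "f a b = g a b"
proof -
  have "f (mon xs) = g (mon xs)" for xs
    by (rule linear_mon_eqI) (use assms in auto)
  then have "(\<lambda>a. f a b) = (\<lambda>a. g a b)"
    by (intro linear_mon_eqI) (use assms in auto)
  then show ?thesis by meson
qed

theorem tensor_universal:
  fixes f :: "('n, 'k::field) ncpoly \<Rightarrow> ('n, 'k) ncpoly \<Rightarrow> 'v::ab_group_add"
  assumes f1: "\<And>a. Vector_Spaces.linear pm_scale s (f a)" and f2: "\<And>b. Vector_Spaces.linear pm_scale s (\<lambda>a. f a b)"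
  shows "\<exists>!g. Vector_Spaces.linear pm_scale s g \<and> (\<forall>a b. g (a \<otimes>\<^sub>t b) = f a b)"
proof -
  interpret v: vector_space s using f1 by (auto simp: Vector_Spaces.linear_def)
  define g where "g = lin_ext s (\<lambda>(u, v). f (mon (letters u)) (mon (letters v)))"
  have lg: "Vector_Spaces.linear pm_scale s g" unfolding g_def by (rule v.linear_lin_ext)
  have "g (a \<otimes>\<^sub>t b) = f a b" for a b
    by (rule bilinear_mon_eqI[where f = "\<lambda>a b. g (a \<otimes>\<^sub>t b)"])
       (rule f1 f2 linear_comp[OF linear_tensor_left lg] linear_comp[OF linear_tensor_right lg]
         | simp add: tensor_mon g_def)+
  then show ?thesis
    using lg by (intro ex1I[of _ g]) (auto intro!: linear_tensor_eqI[where s = s])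
qed

text \<open>The bimodule structure of the tensor square, fixed by its values on the
  basis; \<open>left_act_tensor\<close> and \<open>right_act_tensor\<close> give it on all pure tensors.\<close>

definition left_act :: "('n, 'k::field) ncpoly \<Rightarrow> ('n, 'k) nctensor \<Rightarrow> ('n, 'k) nctensor"
  where "left_act a = lin_ext pm_scale (\<lambda>(u, v). (a * mon (letters u)) \<otimes>\<^sub>t mon (letters v))"

definition right_act :: "('n, 'k::field) nctensor \<Rightarrow> ('n, 'k) ncpoly \<Rightarrow> ('n, 'k) nctensor"
  where "right_act t d = lin_ext pm_scale (\<lambda>(u, v). mon (letters u) \<otimes>\<^sub>t (mon (letters v) * d)) t"

lemma linear_left_act: "Vector_Spaces.linear pm_scale pm_scale (left_act a)"
  unfolding left_act_def by (rule linear_lin_ext_pm)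

lemma linear_right_act: "Vector_Spaces.linear pm_scale pm_scale (\<lambda>t. right_act t d)"
  unfolding right_act_def by (rule linear_lin_ext_pm)

lemma left_act_tensor: "left_act a (b \<otimes>\<^sub>t c) = (a * b) \<otimes>\<^sub>t c"
  by (rule bilinear_mon_eqI[where f = "\<lambda>b c. left_act a (b \<otimes>\<^sub>t c)"])
     (rule linear_comp[OF linear_tensor_left linear_left_act]
        linear_comp[OF linear_tensor_right linear_left_act] linear_tensor_left linear_tensor_right
        linear_comp[OF linear_mult_left linear_tensor_left]
       | simp add: left_act_def tensor_mon)+

lemma right_act_tensor: "right_act (b \<otimes>\<^sub>t c) d = b \<otimes>\<^sub>t (c * d)"
  by (rule bilinear_mon_eqI[where f = "\<lambda>b c. right_act (b \<otimes>\<^sub>t c) d"])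
     (rule linear_comp[OF linear_tensor_left linear_right_act]
        linear_comp[OF linear_tensor_right linear_right_act] linear_tensor_left linear_tensor_right
        linear_comp[OF linear_mult_right linear_tensor_right]
       | simp add: right_act_def tensor_mon)+

section \<open>Difference quotients, cyclic gradient and cyclic symmetrization\<close>

definition is_partial :: "'n \<Rightarrow> (('n, 'k::field) ncpoly \<Rightarrow> ('n, 'k) nctensor) \<Rightarrow> bool"
  where "is_partial j D \<longleftrightarrow>
    Vector_Spaces.linear pm_scale pm_scale D \<and>
    (\<forall>P Q. D (P * Q) = left_act P (D Q) + right_act (D P) Q) \<and>
    (\<forall>k. D (X k) = (if k = j then 1 \<otimes>\<^sub>t 1 else 0))"

text \<open>\<open>ex1_is_partial\<close> shows that the description is well-defined.\<close>

definition partial :: "'n \<Rightarrow> ('n, 'k::field) ncpoly \<Rightarrow> ('n, 'k) nctensor"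
  where "partial j = (THE D. is_partial j D)"

text \<open>\<open>mu_rev\<close> sends \<open>a \<otimes> b\<close> to \<open>b a\<close>, see \<open>mu_rev_tensor\<close>.\<close>

definition mu_rev :: "('n, 'k::field) nctensor \<Rightarrow> ('n, 'k) ncpoly"
  where "mu_rev = lin_ext pm_scale (\<lambda>(u, v). mon (letters v) * mon (letters u))"

definition cyclic_deriv :: "'n \<Rightarrow> ('n, 'k::field) ncpoly \<Rightarrow> ('n, 'k) ncpoly"
  where "cyclic_deriv j = mu_rev \<circ> partial j"

definition cyclic_gradient :: "('n::finite, 'k::field) ncpoly \<Rightarrow> ('n, 'k) ncpoly ^ 'n"
  where "cyclic_gradient P = (\<chi> j. cyclic_deriv j P)"

text \<open>The empty word gives the empty sum, so \<open>1\<close> is sent to \<open>0\<close>.\<close>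

definition cyclic_sym :: "('n, 'k::field) ncpoly \<Rightarrow> ('n, 'k) ncpoly"
  where "cyclic_sym =
    lin_ext pm_scale (\<lambda>w. \<Sum>j = 1..length (letters w). mon (drop j (letters w) @ take j (letters w)))"

definition Ker :: "('a \<Rightarrow> 'b::zero) \<Rightarrow> 'a set"
  where "Ker f = {P. f P = 0}"

lemma mu_rev_tensor:
  fixes a b :: "('n, 'k::field) ncpoly"
  shows "mu_rev (a \<otimes>\<^sub>t b) = b * a"
proof (rule bilinear_mon_eqI[where f = "\<lambda>a b. mu_rev (a \<otimes>\<^sub>t b)" and g = "\<lambda>a b. b * a"])
  have m: "Vector_Spaces.linear pm_scale pm_scale (mu_rev :: ('n, 'k) nctensor \<Rightarrow> _)"
    unfolding mu_rev_def by (rule linear_lin_ext_pm)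
  show "Vector_Spaces.linear pm_scale pm_scale (\<lambda>b::('n, 'k) ncpoly. mu_rev (a \<otimes>\<^sub>t b))"
    "Vector_Spaces.linear pm_scale pm_scale (\<lambda>a::('n, 'k) ncpoly. mu_rev (a \<otimes>\<^sub>t b))" for a b
    by (rule linear_comp[OF linear_tensor_right m] linear_comp[OF linear_tensor_left m])+
qed (rule linear_mult_left linear_mult_right | simp add: mu_rev_def tensor_mon)+

lemma cyclic_sym_mon:
  "cyclic_sym (mon xs) = (\<Sum>j = 1..length xs. mon (drop j xs @ take j xs))"
  by (simp add: cyclic_sym_def mon_def)

primrec dq_word :: "'n \<Rightarrow> 'n list \<Rightarrow> ('n, 'k::field) nctensor"
  where
    "dq_word j [] = 0"
  | "dq_word j (x # xs) = left_act (X x) (dq_word j xs) + (if x = j then 1 \<otimes>\<^sub>t mon xs else 0)"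

lemma linear_left_act_arg:
  fixes t :: "('n, 'k::field) nctensor"
  shows "Vector_Spaces.linear pm_scale pm_scale (\<lambda>a. left_act a t)"
proof (rule linearI_pm)
  fix a b :: "('n, 'k) ncpoly" and c
  have "left_act (a + b) = (\<lambda>t. left_act a t + left_act b t)"
    by (rule linear_tensor_eqI)
       (rule linear_left_act linear_add_pm | simp add: left_act_tensor distrib_right linear_pm_add[OF linear_tensor_left])+
  then show "left_act (a + b) t = left_act a t + left_act b t" by metis
  have "left_act (pm_scale c a) = (\<lambda>t. pm_scale c (left_act a t))"
    by (rule linear_tensor_eqI)
       (rule linear_left_act linear_comp[OF linear_left_act pm.linear_scale_self]
         | simp add: left_act_tensor pm_scale_mult linear_pm_scale[OF linear_tensor_left])+
  then show "left_act (pm_scale c a) t = pm_scale c (left_act a t)" by metis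
qed

lemma linear_right_act_arg:
  fixes t :: "('n, 'k::field) nctensor"
  shows "Vector_Spaces.linear pm_scale pm_scale (right_act t)"
proof (rule linearI_pm)
  fix a b :: "('n, 'k) ncpoly" and c
  have "(\<lambda>t. right_act t (a + b)) = (\<lambda>t. right_act t a + right_act t b)"
    by (rule linear_tensor_eqI)
       (rule linear_right_act linear_add_pm | simp add: right_act_tensor distrib_left linear_pm_add[OF linear_tensor_right])+
  then show "right_act t (a + b) = right_act t a + right_act t b" by metis
  have "(\<lambda>t. right_act t (pm_scale c a)) = (\<lambda>t. pm_scale c (right_act t a))"
    by (rule linear_tensor_eqI)
       (rule linear_right_act linear_comp[OF linear_right_act pm.linear_scale_self]
         | simp add: right_act_tensor pm_scale_mult linear_pm_scale[OF linear_tensor_right])+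
  then show "right_act t (pm_scale c a) = pm_scale c (right_act t a)" by metis
qed

lemma left_act_mult: "left_act (a * b) t = left_act a (left_act b t)"
proof -
  have "left_act (a * b) = (\<lambda>t. left_act a (left_act b t))"
    by (rule linear_tensor_eqI)
       (rule linear_left_act linear_comp[OF linear_left_act linear_left_act]
         | simp add: left_act_tensor mult.assoc)+
  then show ?thesis by metis
qed

lemma left_act_one: "left_act 1 t = t"
proof -
  have "left_act 1 = (\<lambda>t. t)"
    by (rule linear_tensor_eqI) (rule linear_left_act pm.linear_ident | simp add: left_act_tensor)+
  then show ?thesis by metis
qed

lemma right_act_one: "right_act t 1 = t"
proof -
  have "(\<lambda>t. right_act t 1) = (\<lambda>t. t)"
    by (rule linear_tensor_eqI) (rule linear_right_act pm.linear_ident | simp add: right_act_tensor)+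
  then show ?thesis by metis
qed

lemma left_right_act: "right_act (left_act a t) d = left_act a (right_act t d)"
proof -
  have "(\<lambda>t. right_act (left_act a t) d) = (\<lambda>t. left_act a (right_act t d))"
    by (rule linear_tensor_eqI)
       (rule linear_comp[OF linear_left_act linear_right_act]
          linear_comp[OF linear_right_act linear_left_act]
         | simp add: left_act_tensor right_act_tensor)+
  then show ?thesis by metis
qed

lemmas left_act_add = linear_pm_add[OF linear_left_act]
lemmas right_act_add = linear_pm_add[OF linear_right_act]

lemma left_act_zero [simp]: "left_act a 0 = 0"
  using left_act_add[of a 0 0] by simp

lemma right_act_zero [simp]: "right_act 0 d = 0"
  using right_act_add[of 0 0 d] by simp

lemma dq_word_append:
  "dq_word j (xs @ ys) = left_act (mon xs) (dq_word j ys) + right_act (dq_word j xs) (mon ys)"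
proof (induction xs)
  case Nil
  then show ?case by (simp add: mon_Nil left_act_one)
next
  case (Cons x xs)
  then show ?case
    by (simp add: left_act_add right_act_add left_right_act mon_Cons left_act_mult
        right_act_tensor mon_append)
qed

lemma is_partial_lin_ext:
  fixes j :: 'n
  shows "is_partial j (lin_ext pm_scale (\<lambda>w. dq_word j (letters w)) :: ('n, 'k::field) ncpoly \<Rightarrow> _)"
proof -
  define D :: "('n, 'k) ncpoly \<Rightarrow> ('n, 'k) nctensor"
    where "D = lin_ext pm_scale (\<lambda>w. dq_word j (letters w))"
  have lin: "Vector_Spaces.linear pm_scale pm_scale D"
    unfolding D_def by (rule linear_lin_ext_pm)
  have mon: "D (mon xs) = dq_word j xs" for xs
    by (simp add: D_def mon_def)
  have "D (P * Q) = left_act P (D Q) + right_act (D P) Q" for P Q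
  proof (rule bilinear_mon_eqI[where f = "\<lambda>P Q. D (P * Q)"])
    show "D (mon xs * mon ys) = left_act (mon xs) (D (mon ys)) + right_act (D (mon xs)) (mon ys)"
      for xs ys
      by (simp add: mon_append[symmetric] mon dq_word_append)
  qed (rule linear_comp[OF linear_mult_left lin] linear_comp[OF linear_mult_right lin]
         linear_add_pm linear_comp[OF lin linear_left_act] linear_comp[OF lin linear_right_act]
         linear_left_act_arg linear_right_act_arg)+
  moreover have "D (X k) = (if k = j then 1 \<otimes>\<^sub>t 1 else 0)" for k
    by (simp add: X_def mon mon_Nil)
  ultimately show ?thesis
    using lin by (auto simp: is_partial_def D_def[symmetric])
qed

lemma is_partial_unique:
  assumes "is_partial j D" "is_partial j E"
  shows "D = E"
proof (rule linear_mon_eqI)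
  have *: "F 1 = 0" if "is_partial j F" for F :: "('a, 'b) ncpoly \<Rightarrow> _"
  proof -
    have "F (1 * 1) = left_act 1 (F 1) + right_act (F 1) 1"
      using that unfolding is_partial_def by blast
    then show ?thesis by (simp add: left_act_one right_act_one)
  qed
  show "D (mon xs) = E (mon xs)" for xs
  proof (induction xs)
    case Nil
    then show ?case using assms by (simp add: mon_Nil *)
  next
    case (Cons x xs)
    then show ?case using assms by (simp add: mon_Cons is_partial_def)
  qed
qed (use assms in \<open>auto simp: is_partial_def\<close>)

theorem ex1_is_partial: "\<exists>!D. is_partial j D"
proof (rule ex1I)
  show "is_partial j (lin_ext pm_scale (\<lambda>w. dq_word j (letters w)))"
    by (rule is_partial_lin_ext)
qed (rule is_partial_unique[OF _ is_partial_lin_ext])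

theorem is_partial_partial: "is_partial j (partial j)"
  unfolding partial_def by (rule theI'[OF ex1_is_partial])

lemma partial_mon: "partial j (mon xs :: ('n, 'k::field) ncpoly) = dq_word j xs"
proof -
  have "(partial j :: ('n, 'k) ncpoly \<Rightarrow> _) = lin_ext pm_scale (\<lambda>w. dq_word j (letters w))"
    by (rule is_partial_unique[OF is_partial_partial is_partial_lin_ext])
  then show ?thesis by (simp add: mon_def)
qed

end

theory Submission
  imports Defs
begin

text \<open>The four spaces are shown to be included in each other cyclically. Both
  \<open>\<delta>\<^sub>j (P Q)\<close> and \<open>\<delta>\<^sub>j (Q P)\<close> equal \<open>\<mu> (P \<partial>\<^sub>j Q) + \<mu> (Q \<partial>\<^sub>j P)\<close>, where \<open>\<mu> (a \<otimes> b) = b a\<close>, so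
  \<open>\<delta>\<close> kills commutators. The identity \<open>C P = (\<Sum>j. \<delta>\<^sub>j P X\<^sub>j)\<close> shows that \<open>C\<close> vanishes on the
  kernel of \<open>\<delta>\<close>. Finally, modulo \<open>\<Sum>k. [X\<^sub>k, K\<^sub>n]\<close> a word \<open>w\<close> of length \<open>p\<close> is
  congruent to each of its rotations, hence \<open>C w\<close> to \<open>p w\<close>; dividing by \<open>p\<close> in every degree
  shows that an element of the kernel of \<open>C\<close> lies in \<open>(\<Sum>k. [X\<^sub>k, K\<^sub>n]) + K\<close>.\<close>

section \<open>Elementwise sums of subspaces, and linear maps\<close>

lemma subspace_set_plus:
  assumes "pm.subspace V" "pm.subspace W"
  shows "pm.subspace (V + W)"
proof -
  have "V + W = {v + w | v w. v \<in> V \<and> w \<in> W}"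
    by (auto simp: set_plus_def)
  then show ?thesis
    using pm.subspace_sums[OF assms] by simp
qed

lemma subspace_set_sum:
  assumes "\<And>i. i \<in> I \<Longrightarrow> pm.subspace (V i)"
  shows "pm.subspace (\<Sum>i\<in>I. V i)"
  using assms
proof (induction I rule: infinite_finite_induct)
  case (insert i I)
  then show ?case by (simp add: subspace_set_plus)
qed (auto simp: set_zero)

lemma set_sum_upper:
  fixes V :: "'i \<Rightarrow> 'a::comm_monoid_add set"
  assumes "finite I" "i \<in> I" "\<And>j. j \<in> I \<Longrightarrow> 0 \<in> V j"
  shows "V i \<subseteq> (\<Sum>j\<in>I. V j)"
proof
  fix v assume "v \<in> V i"
  then have "\<forall>j\<in>I. (if j = i then v else 0) \<in> V j"
    using assms(3) by auto
  moreover have "v = (\<Sum>j\<in>I. if j = i then v else 0)"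
    using assms(1,2) by simp
  ultimately show "v \<in> (\<Sum>j\<in>I. V j)"
    unfolding set_sum_alt[OF assms(1)] by blast
qed

lemma set_sum_subset_subspace:
  assumes "pm.subspace W" "\<And>i. i \<in> I \<Longrightarrow> V i \<subseteq> W"
  shows "(\<Sum>i\<in>I. V i) \<subseteq> W"
proof (cases "finite I")
  case True
  then show ?thesis
    unfolding set_sum_alt[OF True] using assms(2) by (auto intro!: pm.subspace_sum[OF assms(1)])
next
  case False
  \<comment> \<open>Over an infinite index set the sum of sets takes its default value, the zero
    subspace.\<close>
  then show ?thesis by (simp add: set_zero pm.subspace_0[OF assms(1)])
qed

lemma linear_range_subspaceI:
  fixes f :: "('n, 'k::field) ncpoly \<Rightarrow> ('a \<Rightarrow>\<^sub>0 'k)"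
  assumes "Vector_Spaces.linear pm_scale pm_scale f" "pm.subspace V" "\<And>xs. f (mon xs) \<in> V"
  shows "f P \<in> V"
proof -
  interpret f: Vector_Spaces.linear pm_scale pm_scale f by fact
  have "f (Poly_Mapping.single w 1) \<in> V" for w
    using assms(3)[of "letters w"] by (simp add: mon_def)
  then show ?thesis
    by (subst pm_expand)
      (auto simp: f.sum f.scale intro!: pm.subspace_sum[OF assms(2)] pm.subspace_scale[OF assms(2)])
qed

lemma subspace_Ker:
  "Vector_Spaces.linear pm_scale pm_scale f \<Longrightarrow> pm.subspace (Ker f)"
  unfolding Ker_def
  by (simp add: Vector_Spaces.linear.axioms(3)[THEN module_hom.subspace_kernel])

lemma subspace_constants: "pm.subspace constants"
proof -
  have "constants = range (\<lambda>c. pm_scale c 1)"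
    by (auto simp: constants_def)
  then show ?thesis
    using pm.span_singleton[of 1] pm.subspace_span[of "{1}"] by metis
qed

lemma one_in_constants: "1 \<in> constants"
  unfolding constants_def by (rule CollectI, rule exI[of _ 1]) simp

lemma linear_sum_pm:
  assumes "\<And>i. i \<in> I \<Longrightarrow> Vector_Spaces.linear pm_scale pm_scale (f i)"
  shows "Vector_Spaces.linear pm_scale pm_scale (\<lambda>x. \<Sum>i\<in>I. f i x)"
  by (rule linearI_pm)
    (simp_all add: assms[THEN linear_pm_add] assms[THEN linear_pm_scale] sum.distrib pm.scale_sum_right)

section \<open>Cyclic derivatives and the kernel of the gradient\<close>

lemma linear_mu_rev: "Vector_Spaces.linear pm_scale pm_scale mu_rev"
  unfolding mu_rev_def by (rule linear_lin_ext_pm)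

lemma linear_partial: "Vector_Spaces.linear pm_scale pm_scale (partial j)"
  by (simp add: is_partial_partial[unfolded is_partial_def])

lemma partial_mult: "partial j (P * Q) = left_act P (partial j Q) + right_act (partial j P) Q"
  by (simp add: is_partial_partial[unfolded is_partial_def])

lemma linear_cyclic_deriv: "Vector_Spaces.linear pm_scale pm_scale (cyclic_deriv j)"
  unfolding cyclic_deriv_def o_def by (rule linear_comp[OF linear_partial linear_mu_rev])

lemma linear_cyclic_sym: "Vector_Spaces.linear pm_scale pm_scale cyclic_sym"
  unfolding cyclic_sym_def by (rule linear_lin_ext_pm)

lemma Ker_cyclic_gradient: "Ker cyclic_gradient = (\<Inter>j. Ker (cyclic_deriv j))"
  by (auto simp: Ker_def cyclic_gradient_def vec_eq_iff)

text \<open>On a pure tensor \<open>b \<otimes>\<^sub>t c\<close> both sides are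
  \<open>c * a * b\<close>.\<close>

lemma mu_rev_left_right_act: "mu_rev (left_act a t) = mu_rev (right_act t a)"
proof -
  have "(\<lambda>t. mu_rev (left_act a t)) = (\<lambda>t. mu_rev (right_act t a))"
    by (rule linear_tensor_eqI[OF linear_comp[OF linear_left_act linear_mu_rev]
          linear_comp[OF linear_right_act linear_mu_rev]])
      (simp add: left_act_tensor right_act_tensor mu_rev_tensor mult.assoc)
  then show ?thesis by metis
qed

lemma cyclic_deriv_mult_commute: "cyclic_deriv j (P * Q) = cyclic_deriv j (Q * P)"
  by (simp add: cyclic_deriv_def partial_mult linear_pm_add[OF linear_mu_rev]
      mu_rev_left_right_act add.commute)

lemma commutator_in_Ker_cyclic_deriv: "commutator P Q \<in> Ker (cyclic_deriv j)"
  using linear_pm_add[OF linear_cyclic_deriv, of j "P * Q - Q * P" "Q * P"]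
  by (simp add: Ker_def commutator_def cyclic_deriv_mult_commute)

lemma one_in_Ker_cyclic_deriv: "1 \<in> Ker (cyclic_deriv j)"
  by (simp add: Ker_def cyclic_deriv_def mon_Nil[symmetric] partial_mon mu_rev_def lin_ext_def)

text \<open>The prefix \<open>u\<close> is only needed for the induction; it collects the letters already read.\<close>

lemma sum_mu_rev_dq_word:
  fixes xs u :: "'n::finite list"
  shows "(\<Sum>j\<in>UNIV. mu_rev (left_act (mon u) (dq_word j xs)) * X j)
    = (\<Sum>i = 1..length xs. mon (drop i xs @ u @ take i xs) :: ('n, 'k::field) ncpoly)"
proof (induction xs arbitrary: u)
  case Nil
  then show ?case by (simp add: mu_rev_def lin_ext_def)
next
  case (Cons x xs)
  \<comment> \<open>The first letter is peeled off: if it is \<open>j\<close>, it contributes the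
    rotation that ends in it; in the remaining terms it joins the prefix.\<close>
  have *: "mu_rev (left_act (mon u) (dq_word j (x # xs))) * (X j :: ('n, 'k) ncpoly)
      = (if x = j then mon (xs @ u @ [x]) else 0)
        + mu_rev (left_act (mon (u @ [x])) (dq_word j xs)) * X j" for j
    by (simp add: left_act_add linear_pm_add[OF linear_mu_rev] distrib_right mon_append
        left_act_mult left_act_tensor mu_rev_tensor X_def mult.assoc)
      (simp add: mu_rev_def lin_ext_def)
  have "(\<Sum>i = 1..length (x # xs). mon (drop i (x # xs) @ u @ take i (x # xs)) :: ('n, 'k) ncpoly)
    = mon (xs @ u @ [x]) + (\<Sum>i = 1..length xs. mon (drop i xs @ (u @ [x]) @ take i xs))"
    using sum.atLeast_Suc_atMost_Suc_shift[of "\<lambda>i. mon (drop i (x # xs) @ u @ take i (x # xs)) :: ('n, 'k) ncpoly" 0 "length xs"]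
    by (simp add: sum.atLeast_Suc_atMost o_def atLeast0AtMost[symmetric])
  then show ?case
    unfolding * sum.distrib Cons.IH by simp
qed

text \<open>An occurrence of \<open>X j\<close> splits a word as \<open>a * X j * b\<close> and
  contributes \<open>b * a * X j\<close>, the rotation ending at that occurrence. Summing over
  \<open>j\<close> runs through all positions.\<close>

lemma cyclic_sym_eq_sum_cyclic_deriv:
  fixes P :: "('n::finite, 'k::field) ncpoly"
  shows "cyclic_sym P = (\<Sum>j\<in>UNIV. cyclic_deriv j P * X j)"
proof -
  have "cyclic_sym = (\<lambda>P :: ('n, 'k) ncpoly. \<Sum>j\<in>UNIV. cyclic_deriv j P * X j)"
  proof (rule linear_mon_eqI[OF linear_cyclic_sym])
    show "Vector_Spaces.linear pm_scale pm_scale (\<lambda>P. \<Sum>j\<in>UNIV. cyclic_deriv j P * X j)"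
      by (intro linear_sum_pm linear_comp[OF linear_cyclic_deriv linear_mult_right])
    show "cyclic_sym (mon xs) = (\<Sum>j\<in>UNIV. cyclic_deriv j (mon xs) * X j :: ('n, 'k) ncpoly)" for xs :: "'n list"
      using sum_mu_rev_dq_word[where 'k = 'k and u = "[]" and xs = xs]
      by (simp add: cyclic_sym_mon cyclic_deriv_def partial_mon mon_Nil left_act_one)
  qed
  then show ?thesis by metis
qed

lemma Ker_cyclic_gradient_subset: "Ker cyclic_gradient \<subseteq> Ker cyclic_sym"
  unfolding Ker_cyclic_gradient by (auto simp: Ker_def cyclic_sym_eq_sum_cyclic_deriv)

lemma subspace_commutators: "pm.subspace {commutator (A :: ('n, 'k::field) ncpoly) P | P. True}"
proof -
  have "Vector_Spaces.linear pm_scale pm_scale (commutator A)"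
    by (rule linearI_pm)
      (simp_all add: commutator_def distrib_left distrib_right pm_scale_mult pm.scale_right_diff_distrib)
  then have "pm.subspace (range (commutator A))"
    by (simp add: Vector_Spaces.linear.axioms(3)[THEN module_hom.subspace_image])
  moreover have "{commutator A P | P. True} = range (commutator A)"
    by auto
  ultimately show ?thesis by simp
qed

section \<open>Rotations of words modulo commutators with a letter\<close>

context
  fixes V :: "('n, 'k::field) ncpoly set"
  assumes subspace: "pm.subspace V"
    and commutators: "\<And>k P. commutator (X k) P \<in> V"
begin

text \<open>Moving one letter from the front to the end costs a commutator with that letter;
  \<open>vs\<close> collects the moved letters.\<close>

lemma mon_minus_rotation: "mon (us @ vs) - mon (vs @ us) \<in> V"
proof (induction us arbitrary: vs)
  case Nil
  then show ?case by (simp add: pm.subspace_0[OF subspace])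
next
  case (Cons x us)
  have "commutator (X x) (mon (us @ vs) :: ('n, 'k) ncpoly) = mon (x # us @ vs) - mon (us @ vs @ [x])"
    by (simp add: commutator_def X_def flip: mon_append)
  then show ?case
    using pm.subspace_add[OF subspace commutators[of x "mon (us @ vs)"] Cons.IH[of "vs @ [x]"]]
    by simp
qed

lemma mon_minus_cyclic_sym:
  "pm_scale (of_nat (length xs)) (mon xs) - cyclic_sym (mon xs) \<in> V"
proof -
  \<comment> \<open>The multiple becomes a sum of equal terms, to be compared with the rotations one
    by one.\<close>
  have "pm_scale (of_nat m) P = (\<Sum>i = 1..m. P)" for m and P :: "('n, 'k) ncpoly"
    by (induction m) (simp_all add: pm.scale_left_distrib sum.atLeast1_atMost_eq del: sum_constant)
  from this[of "length xs" "mon xs"]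
  have "pm_scale (of_nat (length xs)) (mon xs) - cyclic_sym (mon xs)
      = (\<Sum>i = 1..length xs. mon (take i xs @ drop i xs) - mon (drop i xs @ take i xs) :: ('n, 'k) ncpoly)"
    by (simp add: cyclic_sym_mon sum_subtractf del: sum_constant)
  also have "\<dots> \<in> V"
    by (intro pm.subspace_sum[OF subspace] mon_minus_rotation)
  finally show ?thesis .
qed

end

text \<open>Division by the degree on each homogeneous component; since \<open>inverse 0 = 0\<close>,
  constants are sent to \<open>0\<close>.\<close>

definition divide_degree :: "('n, 'k::field) ncpoly \<Rightarrow> ('n, 'k) ncpoly"
  where "divide_degree =
    lin_ext pm_scale (\<lambda>w. pm_scale (inverse (of_nat (length (letters w)))) (mon (letters w)))"

lemma linear_divide_degree: "Vector_Spaces.linear pm_scale pm_scale divide_degree"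
  unfolding divide_degree_def by (rule linear_lin_ext_pm)

lemma divide_degree_mon: "divide_degree (mon xs) = pm_scale (inverse (of_nat (length xs))) (mon xs)"
  by (simp add: divide_degree_def mon_def)

text \<open>All rotations of a word have its length, so they are divided by the same number.\<close>

lemma divide_degree_cyclic_sym_mon:
  "divide_degree (cyclic_sym (mon xs)) = pm_scale (inverse (of_nat (length xs))) (cyclic_sym (mon xs))"
  by (simp add: cyclic_sym_mon linear_divide_degree[THEN Vector_Spaces.linear.axioms(3), THEN module_hom.sum]
      divide_degree_mon pm.scale_sum_right)

text \<open>\<open>P - divide_degree (cyclic_sym P)\<close> lies in \<open>V\<close> for every
  \<open>P\<close>, which by linearity is checked on words only; on the kernel the subtracted term
  vanishes.\<close>

lemma Ker_cyclic_sym_subset: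
  fixes V :: "('n, 'k::field_char_0) ncpoly set"
  assumes V: "pm.subspace V" "\<And>k P. commutator (X k) P \<in> V" and "1 \<in> V"
  shows "Ker cyclic_sym \<subseteq> V"
proof
  fix P :: "('n, 'k) ncpoly" assume "P \<in> Ker cyclic_sym"
  then have P: "cyclic_sym P = 0" by (simp add: Ker_def)
  note lin = linear_comp[OF linear_cyclic_sym linear_divide_degree]
  have "P - divide_degree (cyclic_sym P) \<in> V"
  proof (rule linear_range_subspaceI[where f = "\<lambda>P. P - divide_degree (cyclic_sym P)", OF _ V(1)])
    show "Vector_Spaces.linear pm_scale pm_scale (\<lambda>P :: ('n, 'k) ncpoly. P - divide_degree (cyclic_sym P))"
      by (rule linearI_pm)
        (simp_all add: linear_pm_add[OF lin] linear_pm_scale[OF lin] pm.scale_right_diff_distrib)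
    show "mon xs - divide_degree (cyclic_sym (mon xs)) \<in> V" for xs
    proof (cases "xs = []")
      case True
      then show ?thesis
        using \<open>1 \<in> V\<close>
        by (simp add: divide_degree_cyclic_sym_mon) (simp add: mon_Nil)
    next
      case False
      \<comment> \<open>Characteristic zero makes the positive length invertible in the
        field.\<close>
      then have "pm_scale (inverse (of_nat (length xs)))
          (pm_scale (of_nat (length xs)) (mon xs) - cyclic_sym (mon xs))
        = (mon xs - divide_degree (cyclic_sym (mon xs)) :: ('n, 'k) ncpoly)"
        by (simp add: divide_degree_cyclic_sym_mon pm.scale_right_diff_distrib)
      then show ?thesis
        using pm.subspace_scale[OF V(1) mon_minus_cyclic_sym[OF V]] by metis
    qed
  qed
  moreover have "divide_degree 0 = (0 :: ('n, 'k) ncpoly)"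
    by (simp add: divide_degree_def lin_ext_def)
  ultimately show "P \<in> V" by (simp add: P)
qed

theorem theorem2:
  shows "Ker (cyclic_gradient :: ('n::finite, 'k::field_char_0) ncpoly \<Rightarrow> ('n, 'k) ncpoly ^ 'n)
           = (\<Sum>k\<in>(UNIV::'n set). {commutator (X k) P | P. True}) + constants
       \<and> (\<Sum>k\<in>(UNIV::'n set). {commutator (X k) P | P. True}) + constants
           = constants + (commutator_space :: ('n, 'k) ncpoly set)
       \<and> constants + (commutator_space :: ('n, 'k) ncpoly set)
           = Ker (cyclic_sym :: ('n, 'k) ncpoly \<Rightarrow> ('n, 'k) ncpoly)"
proof -
  let ?D = "Ker (cyclic_gradient :: ('n, 'k) ncpoly \<Rightarrow> ('n, 'k) ncpoly ^ 'n)"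
  let ?C = "Ker (cyclic_sym :: ('n, 'k) ncpoly \<Rightarrow> ('n, 'k) ncpoly)"
  let ?S = "\<Sum>k\<in>(UNIV::'n set). {commutator (X k) P | P :: ('n, 'k) ncpoly. True}"
  let ?K = "constants :: ('n, 'k) ncpoly set"
  have S: "pm.subspace ?S"
    by (intro subspace_set_sum subspace_commutators)
  have "commutator (X k) P \<in> ?S" for k and P :: "('n, 'k) ncpoly"
    using set_sum_upper[of UNIV k "\<lambda>k. {commutator (X k) P | P :: ('n, 'k) ncpoly. True}"]
      pm.subspace_0[OF subspace_commutators] by auto
  then have "commutator (X k) P \<in> ?S + ?K" for k and P :: "('n, 'k) ncpoly"
    using set_plus_intro[of _ ?S 0 ?K] pm.subspace_0[OF subspace_constants] by force
  moreover have "1 \<in> ?S + ?K"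
    using set_plus_intro[of 0 ?S 1 ?K] pm.subspace_0[OF S] one_in_constants by force
  ultimately have C: "?C \<subseteq> ?S + ?K"
    by (intro Ker_cyclic_sym_subset subspace_set_plus S subspace_constants)
  have "?S \<subseteq> commutator_space"
    unfolding commutator_space_def
    by (intro set_sum_subset_subspace pm.subspace_span) (auto intro!: pm.span_base)
  then have SK: "?S + ?K \<subseteq> ?K + commutator_space"
    by (subst add.commute) (intro set_plus_mono2 order_refl)
  have D: "pm.subspace ?D"
    unfolding Ker_cyclic_gradient by (intro pm.subspace_Int subspace_Ker linear_cyclic_deriv)
  have "commutator_space \<subseteq> ?D"
    unfolding commutator_space_def
    by (intro pm.span_minimal[OF _ D])
      (auto simp: Ker_cyclic_gradient commutator_in_Ker_cyclic_deriv)
  moreover have "1 \<in> ?D"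
    by (simp add: Ker_cyclic_gradient one_in_Ker_cyclic_deriv)
  then have "?K \<subseteq> ?D"
    by (auto simp: constants_def intro: pm.subspace_scale[OF D])
  ultimately have "?K + commutator_space \<subseteq> ?D"
    using pm.subspace_add[OF D] by (auto elim!: set_plus_elim)
  \<comment> \<open>The cycle closes: \<open>?C \<subseteq> ?S + ?K \<subseteq> ?K +
    commutator_space \<subseteq> ?D \<subseteq> ?C\<close>.\<close>
  with C SK Ker_cyclic_gradient_subset show ?thesis by blast
qed

end
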